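(* Let $X$ be a real Banach space with duality map $J$ and let $B$ be a bounded linear operator on $X$. Suppose that: (1) $A$ generates a $C_0$-semigroup $S(t)$ of contractions on $X$; (2) the mapping $B_J:y\mapsto\langle By,J(y)\rangle$ is single-valued and satisfies $$|B_J(y)-B_J(z)|\le\mathcal{K}(\|y\|,\|z\|)\,\|y-z\|,\qquad\forall y,z\in X,$$ where $\mathcal{K}:\mathbb{R}^+\times\mathbb{R}^+\to\mathbb{R}^+$ is increasing (i.e. $0\le s_1\le r_1$ and $0\le s_2\le r_2$ imply $\mathcal{K}(s_1,s_2)\le\mathcal{K}(r_1,r_2)$), $s\mapsto\mathcal{K}(s,s)$ is continuous, and $\mathcal{K}(s,s)\le Cs$ for all $s\ge0$, for some $C>0$; (3) there exist $T,\delta>0$ such that $$\int_0^T|\langle BS(t)y,J(S(t)y)\rangle|\,dt\ge\delta\|S(T)y\|^2,\qquad\forall y\in X.$$ Then, for all sufficiently small $\lambda>0$, the feedback control $$u(t)=-\lambda\frac{\langle Bz(t),J(z(t))\rangle}{\|z(t)\|^2}\ \text{ if } z(t)\ne0,\qquad u(t)=0\ \text{ if } z(t)=0,$$ ensures the uniform exponential stabilization of the system $$\frac{dz(t)}{dt}=Az(t)+u(t)Bz(t),\qquad z(0)=z_0\in X.$$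
   Context: $\langle y,\phi\rangle$ denotes the duality pairing of $y\in X$ and $\phi\in X^*$. The duality map is $J(y)=\{\phi\in X^*:\ \langle y,\phi\rangle=\|y\|^2=\|\phi\|^2\}$, in general multi-valued. That $B_J$ is single-valued means that $\langle By,y^*\rangle$ takes the same value for all $y^*\in J(y)$; this common value is denoted $\langle By,J(y)\rangle$. A semigroup of contractions satisfies $\|S(t)\|\le1$ for all $t\ge0$. Uniform exponential stabilization means: there are constants $M,\sigma>0$ such that for every $z_0\in X$ the closed-loop system has a unique mild solution $z$ on $[0,+\infty)$ (i.e. continuous with $z(t)=S(t)z_0+\int_0^tS(t-s)u(s)Bz(s)\,ds$, $u$ being the feedback evaluated along $z$) and $\|z(t)\|\le Me^{-\sigma t}\|z_0\|$ for all $t\ge0$. *)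

theory Defs
  imports "HOL-Analysis.Analysis"
begin

definition duality_map :: "'a::real_normed_vector \<Rightarrow> ('a \<Rightarrow>\<^sub>L real) set" where
  "duality_map y =
     {\<phi>. blinfun_apply \<phi> y = (norm y)\<^sup>2 \<and> (norm y)\<^sup>2 = (norm \<phi>)\<^sup>2}"

definition BJ_single_valued :: "('a::real_normed_vector \<Rightarrow>\<^sub>L 'a) \<Rightarrow> bool" where
  "BJ_single_valued B \<longleftrightarrow>
     (\<forall>y. \<forall>\<phi>\<in>duality_map y. \<forall>\<psi>\<in>duality_map y.
        blinfun_apply \<phi> (blinfun_apply B y) = blinfun_apply \<psi> (blinfun_apply B y))"

text \<open>The common value of the pairing of \<open>B y\<close> with the elements of \<open>duality_map y\<close>.
  It is well defined when \<open>B\<close> satisfies \<open>BJ_single_valued\<close>, as \<open>duality_map y\<close> is nonempty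
  by the Hahn-Banach theorem.\<close>

definition BJ :: "('a::real_normed_vector \<Rightarrow>\<^sub>L 'a) \<Rightarrow> 'a \<Rightarrow> real" where
  "BJ B y = (THE c. \<exists>\<phi>\<in>duality_map y. c = blinfun_apply \<phi> (blinfun_apply B y))"

text \<open>Semigroups are functions on all of \<open>real\<close> of which only the values at
  nonnegative times matter.\<close>

definition C0_semigroup :: "(real \<Rightarrow> ('a::real_normed_vector \<Rightarrow>\<^sub>L 'a)) \<Rightarrow> bool" where
  "C0_semigroup S \<longleftrightarrow>
     S 0 = id_blinfun \<and>
     (\<forall>s\<ge>0. \<forall>t\<ge>0. S (s + t) = S s o\<^sub>L S t) \<and>
     (\<forall>x. ((\<lambda>t. blinfun_apply (S t) x) \<longlongrightarrow> x) (at_right 0))"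

definition contraction_semigroup :: "(real \<Rightarrow> ('a::real_normed_vector \<Rightarrow>\<^sub>L 'a)) \<Rightarrow> bool" where
  "contraction_semigroup S \<longleftrightarrow> C0_semigroup S \<and> (\<forall>t\<ge>0. norm (S t) \<le> 1)"

text \<open>An unbounded operator is given by its domain \<open>D\<close> together with a function \<open>A\<close>
  whose values outside \<open>D\<close> are irrelevant.\<close>

definition generates ::
  "'a set \<Rightarrow> ('a \<Rightarrow> 'a) \<Rightarrow> (real \<Rightarrow> ('a::real_normed_vector \<Rightarrow>\<^sub>L 'a)) \<Rightarrow> bool" where
  "generates D A S \<longleftrightarrow>
     C0_semigroup S \<and>
     D = {x. \<exists>y. ((\<lambda>h. (blinfun_apply (S h) x - x) /\<^sub>R h) \<longlongrightarrow> y) (at_right 0)} \<and>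
     (\<forall>x\<in>D. ((\<lambda>h. (blinfun_apply (S h) x - x) /\<^sub>R h) \<longlongrightarrow> A x) (at_right 0))"

text \<open>Mild solutions on \<open>[0, \<infinity>)\<close> of \<open>z' = A z + u B z\<close>, \<open>z 0 = z0\<close>, where \<open>S\<close> is the semigroup
  generated by \<open>A\<close>. The vector-valued integral is that of \<open>has_integral\<close>, since the library's
  Bochner integral needs a separable space.\<close>

definition mild_solution ::
  "(real \<Rightarrow> ('a::real_normed_vector \<Rightarrow>\<^sub>L 'a)) \<Rightarrow> ('a \<Rightarrow>\<^sub>L 'a) \<Rightarrow> (real \<Rightarrow> real) \<Rightarrow> 'a \<Rightarrow> (real \<Rightarrow> 'a) \<Rightarrow> bool"
where
  "mild_solution S B u z0 z \<longleftrightarrow>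
     continuous_on {0..} z \<and>
     (\<forall>t\<ge>0. \<exists>I.
        ((\<lambda>s. blinfun_apply (S (t - s)) (u s *\<^sub>R blinfun_apply B (z s))) has_integral I) {0..t} \<and>
        z t = blinfun_apply (S t) z0 + I)"

definition feedback :: "('a::real_normed_vector \<Rightarrow>\<^sub>L 'a) \<Rightarrow> real \<Rightarrow> 'a \<Rightarrow> real" where
  "feedback B r y = (if y = 0 then 0 else - r * (BJ B y / (norm y)\<^sup>2))"

definition closed_loop_mild_solution ::
  "(real \<Rightarrow> ('a::real_normed_vector \<Rightarrow>\<^sub>L 'a)) \<Rightarrow> ('a \<Rightarrow>\<^sub>L 'a) \<Rightarrow> ('a \<Rightarrow> real) \<Rightarrow> 'a \<Rightarrow> (real \<Rightarrow> 'a) \<Rightarrow> bool"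
where
  "closed_loop_mild_solution S B k z0 z \<longleftrightarrow> mild_solution S B (\<lambda>t. k (z t)) z0 z"

text \<open>Uniqueness of \<open>z\<close> is on \<open>[0, \<infinity>)\<close>, as \<open>z\<close> is arbitrary at negative times.\<close>

definition uniformly_exponentially_stabilizes ::
  "(real \<Rightarrow> ('a::real_normed_vector \<Rightarrow>\<^sub>L 'a)) \<Rightarrow> ('a \<Rightarrow>\<^sub>L 'a) \<Rightarrow> ('a \<Rightarrow> real) \<Rightarrow> bool" where
  "uniformly_exponentially_stabilizes S B k \<longleftrightarrow>
     (\<exists>M>0. \<exists>\<sigma>>0. \<forall>z0. \<exists>z.
        closed_loop_mild_solution S B k z0 z \<and>
        (\<forall>w. closed_loop_mild_solution S B k z0 w \<longrightarrow> (\<forall>t\<ge>0. w t = z t)) \<and>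
        (\<forall>t\<ge>0. norm (z t) \<le> M * exp (- \<sigma> * t) * norm z0))"

end

theory Submission
  imports Defs
begin

text \<open>
  The energy \<open>(norm (z t))\<^sup>2\<close> of a closed-loop solution decreases at least at the rate
  \<open>2 * r * (BJ B (z t))\<^sup>2 / (norm (z t))\<^sup>2\<close>, because a functional in the duality map of \<open>z t\<close> pairs with
  the feedback term to the negative of half of this, while the semigroup does not increase the norm
  (\<open>forced_mild_dissipation\<close>). Suppose that little energy is lost over a period \<open>T\<close>. Then the control
  is small in the mean, and the solution stays close to the free trajectory from the same initial
  value. By the observability inequality, the final energy of the free trajectory is then small too,
  and with it that of the solution. So a fixed fraction of the energy is lost over every period
  in either case (\<open>mild_period_contraction\<close>), and iteration gives exponential decay
  (\<open>exponential_decay\<close>).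

  Well-posedness rests on the fact that the feedback term is globally Lipschitz
  (\<open>rescaled_lipschitz\<close>): the bound \<open>K s s \<le> C * s\<close> makes \<open>BJ B\<close> Lipschitz on a ball with a constant
  proportional to the radius, and the division by \<open>(norm z)\<^sup>2\<close> compensates for exactly this growth.
  A weighted fixed point argument then yields a unique solution on the whole half-line
  (\<open>semilinear_mild_exists\<close>, \<open>semilinear_mild_unique\<close>).

  The pairing argument needs the duality map of every vector to be nonempty
  (\<open>duality_map_nonempty\<close>). This is proved by taking a minimal element among the sublinear
  functionals below a suitable modification of the norm; such a minimal element is linear.
\<close>

section \<open>Norm-attaining functionals\<close>

text \<open>Homogeneity is only required as an inequality, for positive factors: replacing
  \<open>c\<close> by its inverse gives equality, and this form is the cheaper one to verify for infima.\<close>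

definition sublinear :: "('a::real_vector \<Rightarrow> real) \<Rightarrow> bool" where
  "sublinear p \<longleftrightarrow> (\<forall>x y. p (x + y) \<le> p x + p y) \<and> (\<forall>c>0. \<forall>x. p (c *\<^sub>R x) \<le> c * p x)"

lemma sublinear_zero:
  assumes "sublinear p" shows "p 0 = 0"
proof -
  have "p (2 *\<^sub>R 0) \<le> 2 * p 0" "p ((1/2) *\<^sub>R 0) \<le> (1/2) * p 0"
    using assms unfolding sublinear_def by (metis zero_less_numeral, metis half_gt_zero_iff zero_less_one)
  then show ?thesis by simp
qed

lemma sublinear_scaleR:
  assumes "sublinear p" "0 \<le> c" shows "p (c *\<^sub>R x) = c * p x"
proof (cases "c = 0")
  case True
  then show ?thesis using sublinear_zero[OF assms(1)] by simp
next
  case False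
  then have c: "c > 0" using assms by simp
  have "p (inverse c *\<^sub>R (c *\<^sub>R x)) \<le> inverse c * p (c *\<^sub>R x)"
    using assms(1) c unfolding sublinear_def by (meson positive_imp_inverse_positive)
  then have "c * p x \<le> p (c *\<^sub>R x)" using c by (simp add: field_simps)
  then show ?thesis using assms(1) c unfolding sublinear_def by (meson order_antisym)
qed

lemma sublinear_add: "sublinear p \<Longrightarrow> p (x + y) \<le> p x + p y"
  unfolding sublinear_def by blast

lemma sublinear_minus: "sublinear p \<Longrightarrow> - p (- x) \<le> p x"
  using sublinear_add[of p x "- x"] sublinear_zero[of p] by simp

text \<open>An upper bound for the value at \<open>x\<close> of any linear functional below \<open>p\<close> that
  agrees with \<open>p\<close> at \<open>y\<close>: such a functional takes the value \<open>p y\<close> there, and hence cannot exceed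
  \<open>p (x + t *\<^sub>R y) - t * p y\<close> at \<open>x\<close> for any \<open>t \<ge> 0\<close>.\<close>

definition tilt :: "('a::real_vector \<Rightarrow> real) \<Rightarrow> 'a \<Rightarrow> 'a \<Rightarrow> real" where
  "tilt p y x = (INF t\<in>{0..}. p (x + t *\<^sub>R y) - t * p y)"

lemma
  assumes p: "sublinear p"
  shows tilt_le: "0 \<le> t \<Longrightarrow> tilt p y x \<le> p (x + t *\<^sub>R y) - t * p y"
    and sublinear_tilt: "sublinear (tilt p y)"
proof -
  have bdd: "bdd_below ((\<lambda>t. p (x + t *\<^sub>R y) - t * p y) ` {0..})" for x
  proof (rule bdd_belowI2)
    fix t :: real assume "t \<in> {0..}"
    then have "t * p y = p ((x + t *\<^sub>R y) + - x)" by (simp add: sublinear_scaleR[OF p])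
    also have "\<dots> \<le> p (x + t *\<^sub>R y) + p (- x)" by (rule sublinear_add[OF p])
    finally show "- p (- x) \<le> p (x + t *\<^sub>R y) - t * p y" by simp
  qed
  show le: "tilt p y x \<le> p (x + t *\<^sub>R y) - t * p y" if "0 \<le> t" for t x
    unfolding tilt_def by (rule cINF_lower[OF bdd]) (use that in simp)
  have ge: "m \<le> tilt p y x" if "\<And>t. 0 \<le> t \<Longrightarrow> m \<le> p (x + t *\<^sub>R y) - t * p y" for m x
    unfolding tilt_def by (rule cINF_greatest) (use that in auto)
  show "sublinear (tilt p y)"
    unfolding sublinear_def
  proof (intro conjI allI impI)
    fix x x'
    have *: "tilt p y (x + x') \<le> (p (x + t *\<^sub>R y) - t * p y) + (p (x' + t' *\<^sub>R y) - t' * p y)"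
      if "0 \<le> t" "0 \<le> t'" for t t'
    proof -
      have "tilt p y (x + x') \<le> p ((x + t *\<^sub>R y) + (x' + t' *\<^sub>R y)) - (t + t') * p y"
        using le[of "t + t'" "x + x'"] that by (simp add: algebra_simps)
      also have "\<dots> \<le> (p (x + t *\<^sub>R y) - t * p y) + (p (x' + t' *\<^sub>R y) - t' * p y)"
        using sublinear_add[OF p, of "x + t *\<^sub>R y" "x' + t' *\<^sub>R y"] by (simp add: algebra_simps)
      finally show ?thesis .
    qed
    have "tilt p y (x + x') - (p (x + t *\<^sub>R y) - t * p y) \<le> tilt p y x'" if "0 \<le> t" for t
      by (rule ge) (use *[OF that] in \<open>simp add: algebra_simps\<close>)
    then have "tilt p y (x + x') - tilt p y x' \<le> tilt p y x"
      by (intro ge) (simp add: algebra_simps)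
    then show "tilt p y (x + x') \<le> tilt p y x + tilt p y x'" by simp
  next
    fix c :: real and x assume c: "0 < c"
    have "tilt p y (c *\<^sub>R x) / c \<le> tilt p y x"
    proof (rule ge)
      fix t :: real assume t: "0 \<le> t"
      have "tilt p y (c *\<^sub>R x) \<le> p (c *\<^sub>R (x + t *\<^sub>R y)) - c * t * p y"
        using le[of "c * t" "c *\<^sub>R x"] t c by (simp add: algebra_simps)
      also have "\<dots> = c * (p (x + t *\<^sub>R y) - t * p y)"
        using sublinear_scaleR[OF p, of c "x + t *\<^sub>R y"] c by (simp add: algebra_simps)
      finally show "tilt p y (c *\<^sub>R x) / c \<le> p (x + t *\<^sub>R y) - t * p y"
        using c by (simp add: field_simps)
    qed
    then show "tilt p y (c *\<^sub>R x) \<le> c * tilt p y x" using c by (simp add: field_simps)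
  qed
qed

text \<open>Pointwise infima of chains stay finite, because a sublinear \<open>q \<le> p\<close> satisfies
  \<open>q x \<ge> - q (- x) \<ge> - p (- x)\<close>. So Zorn's lemma applies downwards.\<close>

lemma minimal_sublinear_exists:
  fixes p :: "'a::real_vector \<Rightarrow> real"
  assumes p: "sublinear p"
  shows "\<exists>l. sublinear l \<and> l \<le> p \<and> (\<forall>q. sublinear q \<longrightarrow> q \<le> l \<longrightarrow> q = l)"
proof -
  define A where "A = {q. sublinear q \<and> q \<le> p}"
  have "\<exists>m\<in>A. \<forall>a\<in>A. a \<le> m \<longrightarrow> a = m"
  proof (rule predicate_Zorn)
    show "partial_order_on A (relation_of (\<lambda>p q. q \<le> p) A)"
      by (rule partial_order_on_relation_ofI) auto
  next
    fix C assume C: "C \<in> Chains (relation_of (\<lambda>p q. q \<le> p) A)"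
    have CA: "C \<subseteq> A" using Chains_relation_of[OF C] .
    have chain: "q \<le> r \<or> r \<le> q" if "q \<in> C" "r \<in> C" for q r
      using C that unfolding Chains_def relation_of_def by auto
    show "\<exists>u\<in>A. \<forall>a\<in>C. u \<le> a"
    proof (cases "C = {}")
      case True
      then show ?thesis using p unfolding A_def by auto
    next
      case False
      define u where "u x = (INF q\<in>C. q x)" for x
      have bdd: "bdd_below ((\<lambda>q. q x) ` C)" for x
      proof (rule bdd_belowI2)
        fix q assume "q \<in> C"
        then have "sublinear q" "q (- x) \<le> p (- x)" using CA unfolding A_def by (auto simp: le_fun_def)
        then show "- p (- x) \<le> q x" using sublinear_minus[of q x] by linarith
      qed
      have le: "u x \<le> q x" if "q \<in> C" for q x
        unfolding u_def by (rule cINF_lower[OF bdd that])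
      have ge: "m \<le> u x" if "\<And>q. q \<in> C \<Longrightarrow> m \<le> q x" for m x
        unfolding u_def by (rule cINF_greatest[OF False]) (use that in auto)
      have "sublinear u"
        unfolding sublinear_def
      proof (intro conjI allI impI)
        fix x y
        have *: "u (x + y) \<le> q x + r y" if qr: "q \<in> C" "r \<in> C" for q r
        proof -
          obtain s where s: "s \<in> C" "s \<le> q" "s \<le> r" using chain[OF qr] qr by blast
          then have "sublinear s" using CA unfolding A_def by blast
          then have "u (x + y) \<le> s x + s y"
            using le[OF s(1), of "x + y"] sublinear_add[of s x y] by linarith
          then show ?thesis using le_funD[OF s(2), of x] le_funD[OF s(3), of y] by linarith
        qed
        have "u (x + y) - q x \<le> u y" if "q \<in> C" for q
          by (rule ge) (use *[OF that] in \<open>simp add: algebra_simps\<close>)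
        then have "u (x + y) - u y \<le> u x" by (intro ge) (simp add: algebra_simps)
        then show "u (x + y) \<le> u x + u y" by simp
      next
        fix c :: real and x assume c: "0 < c"
        have "u (c *\<^sub>R x) / c \<le> u x"
        proof (rule ge)
          fix q assume q: "q \<in> C"
          then have "q (c *\<^sub>R x) \<le> c * q x" using CA c unfolding A_def sublinear_def by blast
          then show "u (c *\<^sub>R x) / c \<le> q x" using le[OF q, of "c *\<^sub>R x"] c by (simp add: field_simps)
        qed
        then show "u (c *\<^sub>R x) \<le> c * u x" using c by (simp add: field_simps)
      qed
      moreover have "u \<le> p"
      proof -
        obtain q where "q \<in> C" using False by blast
        then have "u \<le> q" "q \<le> p" using le CA unfolding A_def le_fun_def by auto
        then show ?thesis by (rule order_trans)
      qed
      ultimately show ?thesis using le unfolding A_def by (auto simp: le_fun_def)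
    qed
  qed
  then obtain m where m: "m \<in> A" "\<And>a. a \<in> A \<Longrightarrow> a \<le> m \<Longrightarrow> a = m" by blast
  then have "sublinear m" "m \<le> p" unfolding A_def by auto
  moreover have "q = m" if "sublinear q" "q \<le> m" for q
    using m(2)[OF _ that(2)] that order_trans[OF that(2) \<open>m \<le> p\<close>] unfolding A_def by simp
  ultimately show ?thesis by blast
qed

text \<open>A minimal sublinear functional equals all of its tilts. The tilt in direction \<open>x\<close>
  takes a value of at most \<open>- l x\<close> at \<open>- x\<close>, which makes \<open>l\<close> odd; an odd sublinear functional is
  linear.\<close>

lemma minimal_sublinear_linear:
  assumes l: "sublinear l" and min: "\<And>q. sublinear q \<Longrightarrow> q \<le> l \<Longrightarrow> q = l"
  shows "linear l"
proof -
  have neg: "l (- x) = - l x" for x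
  proof -
    have "tilt l x \<le> l" using tilt_le[OF l, of 0] by (simp add: le_fun_def)
    then have "tilt l x = l" using min sublinear_tilt[OF l] by blast
    then have "l (- x) \<le> l (- x + 1 *\<^sub>R x) - 1 * l x" using tilt_le[OF l, of 1 x "- x"] by simp
    then show ?thesis using sublinear_minus[OF l, of x] sublinear_zero[OF l] by simp
  qed
  show ?thesis
  proof (rule linearI)
    fix x y
    show "l (x + y) = l x + l y"
      using sublinear_add[OF l, of x y] sublinear_add[OF l, of "x + y" "- y"] neg[of y] by simp
  next
    fix c x
    show "l (c *\<^sub>R x) = c *\<^sub>R l x"
    proof (cases "0 \<le> c")
      case True
      then show ?thesis using sublinear_scaleR[OF l] by simp
    next
      case False
      then show ?thesis using sublinear_scaleR[OF l, of "- c" x] neg[of "c *\<^sub>R x"] by simp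
    qed
  qed
qed

text \<open>This is the Hahn--Banach theorem for one vector. A linear functional below the tilt of
  the norm in direction \<open>y\<close> lies below the norm, and its value at \<open>- y\<close> is at most \<open>- norm y\<close>; it
  therefore attains the norm at \<open>y\<close>. The duality map contains its multiple by \<open>norm y\<close>.\<close>

lemma duality_map_nonempty: "\<exists>\<phi>. \<phi> \<in> duality_map (y::'a::real_normed_vector)"
proof -
  have n: "sublinear (norm :: 'a \<Rightarrow> real)"
    unfolding sublinear_def by (auto simp: norm_triangle_ineq)
  obtain l where l: "sublinear l" "l \<le> tilt norm y" "\<And>q. sublinear q \<Longrightarrow> q \<le> l \<Longrightarrow> q = l"
    using minimal_sublinear_exists[OF sublinear_tilt[OF n, where y = y]] by blast
  have lin: "linear l" using minimal_sublinear_linear l(1,3) .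
  have le: "l x \<le> norm x" for x
    using le_funD[OF l(2), of x] tilt_le[OF n, of 0 y x] by simp
  have abs: "\<bar>l x\<bar> \<le> norm x" for x
    using le[of x] le[of "- x"] linear_neg[OF lin, of x] by simp
  have "l (- y) \<le> - norm y"
    using le_funD[OF l(2), of "- y"] tilt_le[OF n, of 1 y "- y"] by simp
  then have ly: "l y = norm y" using le[of y] linear_neg[OF lin, of y] by simp
  have bl: "bounded_linear l"
    using lin abs by (auto simp: bounded_linear_def bounded_linear_axioms_def intro!: exI[of _ 1])
  define \<phi> where "\<phi> = norm y *\<^sub>R Blinfun l"
  have ap: "blinfun_apply \<phi> x = norm y * l x" for x
    by (simp add: \<phi>_def scaleR_blinfun.rep_eq bounded_linear_Blinfun_apply[OF bl])
  have "norm \<phi> \<le> norm y"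
    by (rule norm_blinfun_bound) (auto simp: ap abs_mult abs intro!: mult_left_mono)
  moreover have "norm y \<le> norm \<phi>"
  proof (cases "y = 0")
    case False
    have "norm y * norm y \<le> norm \<phi> * norm y" using norm_blinfun[of \<phi> y] by (simp add: ap ly)
    then show ?thesis using False by simp
  qed simp
  ultimately show ?thesis
    by (intro exI[of _ \<phi>]) (simp add: duality_map_def ap ly power2_eq_square)
qed

section \<open>Contraction semigroups and convolutions\<close>

context
  fixes S :: "real \<Rightarrow> ('a::banach \<Rightarrow>\<^sub>L 'a)"
  assumes S: "contraction_semigroup S"
begin

lemma semigroup_zero: "S 0 x = x"
  using S by (simp add: contraction_semigroup_def C0_semigroup_def)

lemma semigroup_add: "0 \<le> s \<Longrightarrow> 0 \<le> t \<Longrightarrow> S (s + t) x = S s (S t x)"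
  using S by (simp add: contraction_semigroup_def C0_semigroup_def)

lemma norm_semigroup_le: "0 \<le> t \<Longrightarrow> norm (S t x) \<le> norm x"
  using S norm_blinfun[of "S t" x] mult_right_mono[of "norm (S t)" 1 "norm x"]
  by (auto simp: contraction_semigroup_def)

lemma norm_semigroup_diff_le: "0 \<le> t \<Longrightarrow> norm (S t x - S t y) \<le> norm (x - y)"
  using norm_semigroup_le[of t "x - y"] by (simp add: blinfun.diff_right)

lemma semigroup_displacement:
  assumes "0 \<le> s" "0 \<le> t"
  shows "norm (S t x - S s x) \<le> norm (S \<bar>t - s\<bar> x - x)"
proof (cases "s \<le> t")
  case True
  then have "S t x = S s (S (t - s) x)" using semigroup_add[of s "t - s" x] assms by simp
  then show ?thesis using norm_semigroup_diff_le[of s] assms True by simp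
next
  case False
  then have "S s x = S t (S (s - t) x)" using semigroup_add[of t "s - t" x] assms by simp
  then show ?thesis
    using norm_semigroup_diff_le[of t x "S (s - t) x"] assms False by (simp add: norm_minus_commute)
qed

lemma orbit_near_zero:
  assumes "0 < e"
  obtains d where "0 < d" "\<And>h. \<bar>h\<bar> < d \<Longrightarrow> norm (S \<bar>h\<bar> x - x) < e"
proof -
  have "((\<lambda>t. S t x) \<longlongrightarrow> x) (at_right 0)"
    using S by (simp add: contraction_semigroup_def C0_semigroup_def)
  then have "\<forall>\<^sub>F t in at_right 0. dist (S t x) x < e" using assms by (rule tendstoD)
  then obtain d where d: "d > 0" "\<And>t. t > 0 \<Longrightarrow> t < d \<Longrightarrow> dist (S t x) x < e"
    by (auto simp: eventually_at_right_field)
  show ?thesis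
  proof (rule that[OF d(1)])
    fix h assume h: "\<bar>h\<bar> < d"
    show "norm (S \<bar>h\<bar> x - x) < e"
      using d(2)[of "\<bar>h\<bar>"] h semigroup_zero assms by (cases "h = 0") (auto simp: dist_norm)
  qed
qed

text \<open>Strong continuity becomes joint continuity in time and in the vector because the maps
  \<open>S t\<close> do not increase distances, uniformly in \<open>t\<close>.\<close>

lemma continuous_on_semigroup:
  fixes f :: "'b::topological_space \<Rightarrow> real"
  assumes f: "continuous_on X f" "\<And>x. x \<in> X \<Longrightarrow> 0 \<le> f x" and g: "continuous_on X g"
  shows "continuous_on X (\<lambda>x. S (f x) (g x))"
  unfolding continuous_on_def
proof
  fix a assume a: "a \<in> X"
  have 1: "isCont (\<lambda>h. S \<bar>h\<bar> (g a) - g a) 0"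
    unfolding isCont_def
  proof (rule tendstoI)
    fix e :: real assume "0 < e"
    then obtain d where "0 < d" "\<And>h. \<bar>h\<bar> < d \<Longrightarrow> norm (S \<bar>h\<bar> (g a) - g a) < e"
      using orbit_near_zero by blast
    then show "\<forall>\<^sub>F h in at 0. dist (S \<bar>h\<bar> (g a) - g a) (S \<bar>0\<bar> (g a) - g a) < e"
      unfolding eventually_at by (intro exI[of _ d]) (auto simp: semigroup_zero)
  qed
  have 2: "((\<lambda>x. f x - f a) \<longlongrightarrow> 0) (at a within X)"
    using f(1) a by (auto simp: continuous_on_def LIM_zero_iff)
  have "((\<lambda>x. S \<bar>f x - f a\<bar> (g a) - g a) \<longlongrightarrow> 0) (at a within X)"
    using isCont_tendsto_compose[OF 1 2] by (simp add: semigroup_zero)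
  then have lim: "((\<lambda>x. norm (g x - g a) + norm (S \<bar>f x - f a\<bar> (g a) - g a)) \<longlongrightarrow> 0 + 0) (at a within X)"
    using g a by (intro tendsto_add tendsto_norm_zero) (auto simp: continuous_on_def LIM_zero_iff)
  have "norm (S (f x) (g x) - S (f a) (g a)) \<le>
      norm (g x - g a) + norm (S \<bar>f x - f a\<bar> (g a) - g a)" if "x \<in> X" for x
  proof -
    have "norm (S (f x) (g x) - S (f a) (g a)) \<le>
        norm (S (f x) (g x) - S (f x) (g a)) + norm (S (f x) (g a) - S (f a) (g a))"
      using norm_triangle_ineq[of "S (f x) (g x) - S (f x) (g a)" "S (f x) (g a) - S (f a) (g a)"]
      by simp
    then show ?thesis
      using norm_semigroup_diff_le[OF f(2)[OF that], of "g x" "g a"]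
        semigroup_displacement[OF f(2)[OF a] f(2)[OF that], of "g a"] by linarith
  qed
  then have "\<forall>\<^sub>F x in at a within X. norm (S (f x) (g x) - S (f a) (g a)) \<le>
      norm (g x - g a) + norm (S \<bar>f x - f a\<bar> (g a) - g a)"
    by (auto simp: eventually_at_filter)
  then have "((\<lambda>x. S (f x) (g x) - S (f a) (g a)) \<longlongrightarrow> 0) (at a within X)"
    by (rule Lim_null_comparison) (use lim in simp)
  then show "((\<lambda>x. S (f x) (g x)) \<longlongrightarrow> S (f a) (g a)) (at a within X)"
    by (simp add: LIM_zero_iff)
qed

lemma convolution_integrable:
  assumes "continuous_on {0..} g" "0 \<le> a"
  shows "(\<lambda>s. S (t - s) (g s)) integrable_on {a..t}"
  by (intro integrable_continuous_interval continuous_on_semigroup continuous_intros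
      continuous_on_subset[OF assms(1)]) (use assms in auto)

text \<open>The gain \<open>1 / \<mu>\<close> over the exponentially weighted bound for \<open>g\<close> is what makes the integral
  equation a contraction once \<open>\<mu>\<close> exceeds the Lipschitz constant of the nonlinearity.\<close>

lemma convolution_norm_le:
  assumes I: "((\<lambda>s. S (t - s) (g s)) has_integral I) {0..t}"
    and "0 < \<mu>" "0 \<le> t"
    and g: "\<And>s. 0 \<le> s \<Longrightarrow> s \<le> t \<Longrightarrow> norm (g s) \<le> m * exp (\<mu> * s)"
  shows "norm I \<le> m / \<mu> * exp (\<mu> * t)"
proof -
  have "((\<lambda>s. m * exp (\<mu> * s)) has_integral m / \<mu> * exp (\<mu> * t) - m / \<mu> * exp (\<mu> * 0)) {0..t}"
    by (rule fundamental_theorem_of_calculus)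
      (use assms in \<open>auto simp: has_real_derivative_iff_has_vector_derivative[symmetric]
        intro!: derivative_eq_intros\<close>)
  moreover have "norm (S (t - s) (g s)) \<le> (m * exp (\<mu> * s)) \<bullet> 1" if "s \<in> {0..t}" for s
    using norm_semigroup_le[of "t - s" "g s"] g[of s] that by simp
  ultimately have "norm I \<le> (m / \<mu> * exp (\<mu> * t) - m / \<mu> * exp (\<mu> * 0)) \<bullet> 1"
    using has_integral_norm_bound_integral_component[OF I] by blast
  moreover have "0 \<le> m" using g[of 0] assms(3) order_trans[OF norm_ge_zero, of "g 0" m] by simp
  then have "0 \<le> m / \<mu>" using assms(2) by simp
  ultimately show ?thesis by simp
qed

text \<open>The substitution \<open>s = t * s'\<close> moves the variable endpoint \<open>t\<close> into the integrand, after
  which the continuity of parameter integrals over a fixed interval applies.\<close>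

lemma continuous_on_convolution:
  assumes g: "continuous_on {0..} g"
  shows "continuous_on {0..} (\<lambda>t. integral {0..t} (\<lambda>s. S (t - s) (g s)))"
proof -
  have eq: "integral {0..t} (\<lambda>s. S (t - s) (g s)) =
      t *\<^sub>R integral (cbox 0 1) (\<lambda>s. S (t - t * s) (g (t * s)))" if "t \<in> {0..}" for t
  proof (cases "t = 0")
    case False
    then have t: "t > 0" using that by simp
    have "((\<lambda>s. S (t - t * s) (g (t * s))) has_integral
        (1 / \<bar>t\<bar>) *\<^sub>R integral {0..t} (\<lambda>s. S (t - s) (g s))) ((\<lambda>x. x / t) ` {0..t})"
      using has_integral_stretch_real[OF integrable_integral[OF convolution_integrable[OF g order_refl, of t]] False]
      by simp
    moreover have "(\<lambda>x. x / t) ` {0..t} = cbox 0 1"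
      using t by (simp add: image_divide_atLeastAtMost)
    ultimately show ?thesis using t by (simp add: integral_unique)
  qed simp
  have "continuous_on {0..} (\<lambda>t. t *\<^sub>R integral (cbox 0 1) (\<lambda>s. S (t - t * s) (g (t * s))))"
  proof (intro continuous_intros integral_continuous_on_param)
    have "continuous_on ({0..} \<times> cbox 0 1) (\<lambda>x. g (fst x * snd x))"
      by (rule continuous_on_compose2[OF g]) (auto intro!: continuous_intros)
    then show "continuous_on ({0..} \<times> cbox 0 1) (\<lambda>(t, s). S (t - t * s) (g (t * s)))"
      unfolding split_beta
      by (intro continuous_on_semigroup continuous_intros) (auto intro: mult_left_le)
  qed
  then show ?thesis by (rule continuous_on_eq) (simp only: eq)
qed

end

section \<open>Mild solutions\<close>

text \<open>Mild solutions of \<open>z' = A z + g\<close> for a given forcing term \<open>g\<close>. A closed-loop solution is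
  one whose forcing is computed from \<open>z\<close> itself; keeping \<open>g\<close> separate lets the restart property and
  the energy inequality be proved without reference to the feedback.\<close>

definition forced_mild ::
  "(real \<Rightarrow> ('a::real_normed_vector \<Rightarrow>\<^sub>L 'a)) \<Rightarrow> (real \<Rightarrow> 'a) \<Rightarrow> 'a \<Rightarrow> (real \<Rightarrow> 'a) \<Rightarrow> bool" where
  "forced_mild S g z0 z \<longleftrightarrow> continuous_on {0..} z \<and>
     (\<forall>t\<ge>0. ((\<lambda>s. S (t - s) (g s)) has_integral z t - S t z0) {0..t})"

lemma forced_mild_continuous: "forced_mild S g z0 z \<Longrightarrow> continuous_on {0..} z"
  by (simp add: forced_mild_def)

lemma forced_mild_has_integral:
  "forced_mild S g z0 z \<Longrightarrow> 0 \<le> t \<Longrightarrow> ((\<lambda>s. S (t - s) (g s)) has_integral z t - S t z0) {0..t}"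
  by (simp add: forced_mild_def)

lemma continuous_on_lipschitz:
  fixes F :: "'a::real_normed_vector \<Rightarrow> 'b::real_normed_vector"
  assumes "\<And>x y. norm (F x - F y) \<le> L * norm (x - y)" and v: "continuous_on A v"
  shows "continuous_on A (\<lambda>s. F (v s))"
proof -
  have "(max L 0)-lipschitz_on UNIV F"
    by (rule lipschitz_onI)
      (auto simp: dist_norm intro!: order_trans[OF assms(1)] mult_right_mono)
  then have "continuous_on UNIV F" by (rule lipschitz_on_continuous_on)
  then show ?thesis using continuous_on_compose2[OF _ v] by blast
qed

context
  fixes S :: "real \<Rightarrow> ('a::banach \<Rightarrow>\<^sub>L 'a)"
  assumes S: "contraction_semigroup S"
begin

lemma forced_mild_zero:
  assumes "forced_mild S g z0 z" shows "z 0 = z0"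
proof -
  have "((\<lambda>s. S (0 - s) (g s)) has_integral z 0 - z0) {0}"
    using forced_mild_has_integral[OF assms, of 0] by (simp add: semigroup_zero[OF S])
  then have "z 0 - z0 = 0" using has_integral_refl(2) by (rule has_integral_unique)
  then show ?thesis by simp
qed

text \<open>The semigroup law splits the variation-of-constants formula at time \<open>a\<close>: the integral
  over \<open>{0..a}\<close>, transported by \<open>S t\<close>, combines with \<open>S (a + t) z0\<close> into \<open>S t (z a)\<close>.\<close>

lemma forced_mild_restart:
  assumes z: "forced_mild S g z0 z" and g: "continuous_on {0..} g" and a: "0 \<le> a"
  shows "forced_mild S (\<lambda>s. g (a + s)) (z a) (\<lambda>s. z (a + s))"
  unfolding forced_mild_def
proof (intro conjI allI impI)
  show "continuous_on {0..} (\<lambda>s. z (a + s))"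
    by (rule continuous_on_compose2[OF forced_mild_continuous[OF z]])
      (use a in \<open>auto intro!: continuous_intros\<close>)
next
  fix t :: real assume t: "0 \<le> t"
  let ?f = "\<lambda>s. S (a + t - s) (g s)"
  have "((\<lambda>s. S t (S (a - s) (g s))) has_integral S t (z a - S a z0)) {0..a}"
    using has_integral_linear[OF forced_mild_has_integral[OF z a] blinfun.bounded_linear_right[of "S t"]]
    by (simp add: o_def)
  moreover have "S t (S (a - s) (g s)) = ?f s" if "s \<in> {0..a}" for s
    using semigroup_add[OF S, of t "a - s" "g s"] that t by (simp add: algebra_simps)
  ultimately have 1: "(?f has_integral S t (z a - S a z0)) {0..a}"
    by (rule has_integral_eq[rotated])
  obtain J where J: "(?f has_integral J) {a..a + t}"
    using convolution_integrable[OF S g a, of "a + t"] by blast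
  have "(?f has_integral S t (z a - S a z0) + J) {0..a + t}"
    by (rule has_integral_combine[OF _ _ 1 J]) (use a t in auto)
  moreover have "(?f has_integral z (a + t) - S (a + t) z0) {0..a + t}"
    by (rule forced_mild_has_integral[OF z]) (use a t in simp)
  ultimately have "S t (z a - S a z0) + J = z (a + t) - S (a + t) z0"
    by (rule has_integral_unique)
  then have "J = z (a + t) - S t (z a)"
    using semigroup_add[OF S t a, of z0] by (simp add: blinfun.diff_right algebra_simps)
  then have "((?f \<circ> (+) a) has_integral z (a + t) - S t (z a)) {0..t}"
    using J by (simp add: has_integral_shift_Icc_real add.commute)
  then show "((\<lambda>s. S (t - s) (g (a + s))) has_integral z (a + t) - S t (z a)) {0..t}"
    by (simp add: o_def)
qed

text \<open>Banach's fixed point theorem on the whole half-line at once, for the unknown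
  \<open>v t = exp (- \<mu> * t) *\<^sub>R z t\<close> among the bounded continuous functions. The weight turns the Lipschitz
  constant \<open>L\<close> of the integral equation into \<open>L / \<mu>\<close>, which is at most 1/2 for \<open>\<mu> = 2 * L + 1\<close>.\<close>

lemma semilinear_mild_exists:
  assumes L: "0 \<le> L" and F: "\<And>x y. norm (F x - F y) \<le> L * norm (x - y)"
  shows "\<exists>z. forced_mild S (\<lambda>s. F (z s)) z0 z"
proof -
  define \<mu> where "\<mu> = 2 * L + 1"
  have \<mu>: "0 < \<mu>" "L / \<mu> \<le> 1/2" using L by (auto simp: \<mu>_def field_simps)
  define g where "g v s = F (exp (\<mu> * s) *\<^sub>R apply_bcontfun v s)" for v s
  have g: "continuous_on A (g v)" for A v
    unfolding g_def
    by (intro continuous_on_lipschitz[OF F] continuous_on_scaleR continuous_on_exp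
        continuous_on_mult continuous_on_const continuous_on_id continuous_on_apply_bcontfun)
  define W where "W v t = S t z0 + integral {0..t} (\<lambda>s. S (t - s) (g v s))" for v t
  have W: "continuous_on {0..} (W v)" for v
    unfolding W_def
    by (intro continuous_intros continuous_on_semigroup[OF S] continuous_on_convolution[OF S] g) auto
  \<comment> \<open>Functions on all of \<open>real\<close> are used; negative times are clamped to 0.\<close>
  define \<Phi> where "\<Phi> v t = exp (- \<mu> * max 0 t) *\<^sub>R W v (max 0 t)" for v t
  have integ: "((\<lambda>s. S (t - s) (g v s)) has_integral integral {0..t} (\<lambda>s. S (t - s) (g v s))) {0..t}"
    for v t
    by (rule integrable_integral) (rule convolution_integrable[OF S g order_refl])
  have "\<Phi> v \<in> bcontfun" for v
    unfolding bcontfun_def mem_Collect_eq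
  proof
    have "continuous_on {0..} (\<lambda>t. exp (- \<mu> * t) *\<^sub>R W v t)"
      by (intro continuous_intros W)
    then show "continuous_on UNIV (\<Phi> v)"
      unfolding \<Phi>_def by (rule continuous_on_compose2) (auto intro!: continuous_intros)
    obtain b where b: "\<And>s. norm (apply_bcontfun v s) \<le> b"
      using bounded_apply_bcontfun[of v] unfolding bounded_iff by auto
    have "norm (\<Phi> v t) \<le> norm z0 + (norm (F 0) + L * b) / \<mu>" for t
    proof -
      define \<tau> where "\<tau> = max 0 t"
      have \<tau>: "0 \<le> \<tau>" by (simp add: \<tau>_def)
      have "norm (g v s) \<le> (norm (F 0) + L * b) * exp (\<mu> * s)" if "0 \<le> s" for s
      proof -
        have "norm (g v s) \<le> norm (F 0) + norm (g v s - F 0)"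
          using norm_triangle_ineq[of "F 0" "g v s - F 0"] by simp
        also have "\<dots> \<le> norm (F 0) + L * (exp (\<mu> * s) * b)"
          using F[of "exp (\<mu> * s) *\<^sub>R v s" 0] mult_left_mono[OF b[of s], of "L * exp (\<mu> * s)"] L
          by (simp add: g_def mult.assoc)
        also have "\<dots> \<le> norm (F 0) * exp (\<mu> * s) + L * (exp (\<mu> * s) * b)"
          using that \<mu> by (simp add: mult_le_cancel_left1)
        finally show ?thesis by (simp add: algebra_simps)
      qed
      then have "norm (W v \<tau>) \<le> norm z0 + (norm (F 0) + L * b) / \<mu> * exp (\<mu> * \<tau>)"
        unfolding W_def
        by (intro norm_triangle_mono norm_semigroup_le[OF S \<tau>] convolution_norm_le[OF S integ \<mu>(1) \<tau>])
      then have "exp (- \<mu> * \<tau>) * norm (W v \<tau>) \<le>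
          exp (- \<mu> * \<tau>) * (norm z0 + (norm (F 0) + L * b) / \<mu> * exp (\<mu> * \<tau>))"
        by (rule mult_left_mono) simp
      also have "\<dots> = exp (- \<mu> * \<tau>) * norm z0 + (norm (F 0) + L * b) / \<mu>"
        by (simp add: algebra_simps exp_minus)
      also have "\<dots> \<le> norm z0 + (norm (F 0) + L * b) / \<mu>"
        using \<tau> \<mu> by (simp add: mult_left_le_one_le)
      finally show ?thesis by (simp add: \<Phi>_def \<tau>_def)
    qed
    then show "bounded (range (\<Phi> v))" unfolding bounded_iff by auto
  qed
  then have ap: "apply_bcontfun (Bcontfun (\<Phi> v)) = \<Phi> v" for v by (simp add: Bcontfun_inverse)
  have "dist (Bcontfun (\<Phi> v)) (Bcontfun (\<Phi> w)) \<le> 1/2 * dist v w" for v w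
  proof (rule dist_bound)
    fix t :: real
    define \<tau> where "\<tau> = max 0 t"
    have \<tau>: "0 \<le> \<tau>" by (simp add: \<tau>_def)
    have "norm (g v s - g w s) \<le> (L * dist v w) * exp (\<mu> * s)" for s
    proof -
      have "norm (g v s - g w s) \<le> L * norm (exp (\<mu> * s) *\<^sub>R (v s - w s))"
        using F unfolding g_def scaleR_diff_right .
      also have "\<dots> \<le> L * (exp (\<mu> * s) * dist v w)"
        using dist_bounded[of v s w] L by (intro mult_left_mono) (auto simp: dist_norm)
      finally show ?thesis by (simp add: algebra_simps)
    qed
    moreover have "((\<lambda>s. S (\<tau> - s) (g v s - g w s)) has_integral W v \<tau> - W w \<tau>) {0..\<tau>}"
      unfolding W_def using has_integral_diff[OF integ integ, of \<tau> v w]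
      by (simp add: blinfun.diff_right)
    ultimately have "norm (W v \<tau> - W w \<tau>) \<le> (L * dist v w) / \<mu> * exp (\<mu> * \<tau>)"
      by (intro convolution_norm_le[OF S _ \<mu>(1) \<tau>])
    then have "exp (- \<mu> * \<tau>) * norm (W v \<tau> - W w \<tau>) \<le>
        exp (- \<mu> * \<tau>) * ((L * dist v w) / \<mu> * exp (\<mu> * \<tau>))"
      by (rule mult_left_mono) simp
    also have "\<dots> = L / \<mu> * dist v w" by (simp add: exp_minus)
    also have "\<dots> \<le> 1/2 * dist v w" using \<mu>(2) by (intro mult_right_mono) auto
    finally show "dist (Bcontfun (\<Phi> v) t) (Bcontfun (\<Phi> w) t) \<le> 1/2 * dist v w"
      unfolding ap by (simp add: \<Phi>_def \<tau>_def dist_norm flip: scaleR_diff_right)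
  qed
  then obtain v where "Bcontfun (\<Phi> v) = v"
    using banach_fix_type[of "1/2" "\<lambda>v. Bcontfun (\<Phi> v)"] by auto
  then have v: "apply_bcontfun v t = \<Phi> v t" for t using ap[of v] by simp
  define z where "z t = exp (\<mu> * t) *\<^sub>R apply_bcontfun v t" for t
  have "z t = W v t" if "0 \<le> t" for t
    using that v[of t] by (simp add: z_def \<Phi>_def flip: exp_add)
  moreover have "(\<lambda>s. F (z s)) = g v" by (simp add: z_def g_def fun_eq_iff)
  moreover have "continuous_on {0..} z"
    unfolding z_def by (intro continuous_intros) auto
  ultimately have "forced_mild S (\<lambda>s. F (z s)) z0 z" using integ by (simp add: forced_mild_def W_def)
  then show ?thesis by blast
qed

text \<open>The weighted distance of two solutions attains its maximum over \<open>{0..t}\<close>, and the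
  integral equation bounds this maximum by half of itself.\<close>

lemma semilinear_mild_unique:
  assumes L: "0 \<le> L" and F: "\<And>x y. norm (F x - F y) \<le> L * norm (x - y)"
    and z: "forced_mild S (\<lambda>s. F (z s)) z0 z" and w: "forced_mild S (\<lambda>s. F (w s)) z0 w" and t: "0 \<le> t"
  shows "w t = z t"
proof -
  define \<mu> where "\<mu> = 2 * L + 1"
  have \<mu>: "0 < \<mu>" "L / \<mu> \<le> 1/2" using L by (auto simp: \<mu>_def field_simps)
  define e where "e s = exp (- \<mu> * s) * norm (w s - z s)" for s
  have "continuous_on {0..t} e"
    unfolding e_def
    by (intro continuous_intros continuous_on_subset[OF forced_mild_continuous[OF z]]
        continuous_on_subset[OF forced_mild_continuous[OF w]]) auto
  then obtain r where r: "r \<in> {0..t}" "\<And>s. s \<in> {0..t} \<Longrightarrow> e s \<le> e r"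
    using continuous_attains_sup[of "{0..t}" e] t by auto
  have "((\<lambda>s. S (r - s) (F (w s) - F (z s))) has_integral w r - z r) {0..r}"
    using has_integral_diff[OF forced_mild_has_integral[OF w, of r] forced_mild_has_integral[OF z, of r]] r
    by (simp add: blinfun.diff_right)
  moreover have "norm (F (w s) - F (z s)) \<le> (L * e r) * exp (\<mu> * s)" if "0 \<le> s" "s \<le> r" for s
  proof -
    have "norm (F (w s) - F (z s)) \<le> L * norm (w s - z s)" by (rule F)
    also have "norm (w s - z s) = e s * exp (\<mu> * s)" by (simp add: e_def exp_minus field_simps)
    also have "L * (e s * exp (\<mu> * s)) \<le> L * (e r * exp (\<mu> * s))"
      using r that L by (intro mult_left_mono mult_right_mono) auto
    finally show ?thesis by simp
  qed
  ultimately have "norm (w r - z r) \<le> L * e r / \<mu> * exp (\<mu> * r)"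
    using r by (intro convolution_norm_le[OF S _ \<mu>(1)]) auto
  then have "exp (- \<mu> * r) * norm (w r - z r) \<le> exp (- \<mu> * r) * (L * e r / \<mu> * exp (\<mu> * r))"
    by (rule mult_left_mono) simp
  also have "\<dots> = L / \<mu> * e r" by (simp add: exp_minus)
  also have "\<dots> \<le> 1/2 * e r" using \<mu>(2) by (intro mult_right_mono) (auto simp: e_def)
  finally have "e r \<le> 0" by (simp add: e_def)
  moreover have "e t \<le> e r" using r t by simp
  ultimately have "exp (- \<mu> * t) * norm (w t - z t) \<le> 0" by (simp add: e_def)
  then show ?thesis by (simp add: mult_le_0_iff)
qed

text \<open>Formally, \<open>d/dt (norm (z t))\<^sup>2 = 2 * \<phi> (A (z t) + g t)\<close> for \<open>\<phi>\<close> in the duality map of \<open>z t\<close>, and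
  \<open>A\<close> is dissipative. A mild solution need not be differentiable, so the estimate is made on short
  intervals \<open>{s..t}\<close> instead, with \<open>\<phi>\<close> taken at the right endpoint, as in an implicit Euler step:
  applying \<open>\<phi>\<close> to the variation-of-constants formula from \<open>s\<close> to \<open>t\<close> gives
  \<open>(norm (z t))\<^sup>2 \<le> norm (z t) * norm (z s) - (t - s) * p t\<close> up to an error of \<open>o(t - s)\<close>, since
  \<open>S (t - \<sigma>) (g \<sigma>)\<close> is close to \<open>g t\<close>. Bolzano's bisection principle joins the short intervals.\<close>

lemma forced_mild_dissipation:
  assumes z: "forced_mild S g z0 z" and g: "continuous_on {0..} g" and p: "continuous_on {0..} p"
    and diss: "\<And>t. 0 \<le> t \<Longrightarrow> \<exists>\<phi>\<in>duality_map (z t). blinfun_apply \<phi> (g t) \<le> - p t"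
    and ab: "0 \<le> a" "a \<le> b"
  shows "(norm (z b))\<^sup>2 + 2 * integral {a..b} p \<le> (norm (z a))\<^sup>2"
proof -
  have pint: "p integrable_on {s..t}" if "0 \<le> s" for s t
    by (rule integrable_continuous_interval, rule continuous_on_subset[OF p]) (use that in auto)
  have approx: "(norm (z b))\<^sup>2 + 2 * integral {a..b} p \<le> (norm (z a))\<^sup>2 + \<eta> * (b - a)" if \<eta>: "0 < \<eta>" for \<eta>
  proof -
    define P where "P s t \<longleftrightarrow> (0 \<le> s \<longrightarrow> s \<le> t \<longrightarrow>
      (norm (z t))\<^sup>2 + 2 * integral {s..t} p \<le> (norm (z s))\<^sup>2 + \<eta> * (t - s))" for s t
    have "P a b"
      using ab(2)
    proof (induction rule: Bolzano)
      case (trans r s t)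
      show ?case
        unfolding P_def
      proof (intro impI)
        assume r: "0 \<le> r" "r \<le> t"
        then show "(norm (z t))\<^sup>2 + 2 * integral {r..t} p \<le> (norm (z r))\<^sup>2 + \<eta> * (t - r)"
          using trans Henstock_Kurzweil_Integration.integral_combine[OF trans(3,4) pint[OF r(1)]] unfolding P_def
          by (simp add: algebra_simps)
      qed
    next
      case (local x)
      then have x: "x \<in> {0..}" using ab by simp
      define N where "N = norm (z x) + 1"
      have N: "0 < N" by (simp add: N_def add_nonneg_pos)
      \<comment> \<open>The errors below add up to \<open>(6 * N + 4) * \<epsilon>\<close> per unit of time:
        twice \<open>3 * N * \<epsilon>\<close> from the forcing, and four times \<open>\<epsilon>\<close> from comparing \<open>p\<close> with \<open>p x\<close>.\<close>
      define \<epsilon> where "\<epsilon> = \<eta> / (6 * N + 4)"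
      have \<epsilon>: "0 < \<epsilon>" using \<eta> N by (simp add: \<epsilon>_def)
      have eta: "(6 * N + 4) * \<epsilon> = \<eta>" using N by (simp add: \<epsilon>_def)
      obtain d1 where d1: "0 < d1" "\<And>s. 0 \<le> s \<Longrightarrow> \<bar>s - x\<bar> < d1 \<Longrightarrow> norm (z s - z x) < 1"
        using forced_mild_continuous[OF z] x unfolding continuous_on_iff
        by (metis atLeast_iff dist_norm real_norm_def zero_less_one)
      obtain d2 where d2: "0 < d2" "\<And>s. 0 \<le> s \<Longrightarrow> \<bar>s - x\<bar> < d2 \<Longrightarrow> norm (g s - g x) < \<epsilon>"
        using g x \<epsilon> unfolding continuous_on_iff by (metis atLeast_iff dist_norm real_norm_def)
      obtain d3 where d3: "0 < d3" "\<And>s. 0 \<le> s \<Longrightarrow> \<bar>s - x\<bar> < d3 \<Longrightarrow> \<bar>p s - p x\<bar> < \<epsilon>"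
        using p x \<epsilon> unfolding continuous_on_iff by (metis atLeast_iff dist_norm real_norm_def)
      obtain d4 where d4: "0 < d4" "\<And>h. \<bar>h\<bar> < d4 \<Longrightarrow> norm (S \<bar>h\<bar> (g x) - g x) < \<epsilon>"
        using orbit_near_zero[OF S \<epsilon>] by blast
      define d where "d = Min {d1, d2, d3, d4}"
      have d: "0 < d" "d \<le> d1" "d \<le> d2" "d \<le> d3" "d \<le> d4"
        using d1 d2 d3 d4 by (auto simp: d_def)
      have "P s t" if st: "s \<le> x" "x \<le> t" "t - s < d" for s t
        unfolding P_def
      proof (intro impI)
        assume s: "0 \<le> s" and "s \<le> t"
        have t: "0 \<le> t" using s \<open>s \<le> t\<close> by simp
        obtain \<phi> where \<phi>: "\<phi> \<in> duality_map (z t)" "\<phi> (g t) \<le> - p t" using diss[OF t] by blast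
        have \<phi>z: "\<phi> (z t) = (norm (z t))\<^sup>2" and n\<phi>: "norm \<phi> = norm (z t)"
          using \<phi>(1) by (auto simp: duality_map_def power2_eq_iff_nonneg)
        have zt: "norm (z t) \<le> N"
          using d1(2)[OF t] norm_triangle_ineq2[of "z t" "z x"] st d by (simp add: N_def)
        have gt: "norm (g t - g x) < \<epsilon>" and pt: "\<bar>p t - p x\<bar> < \<epsilon>"
          using d2(2)[OF t] d3(2)[OF t] st d by auto
        have "((\<lambda>\<sigma>. S (t - s - \<sigma>) (g (s + \<sigma>))) has_integral z t - S (t - s) (z s)) {0..t - s}"
          using forced_mild_has_integral[OF forced_mild_restart[OF z g s], of "t - s"] \<open>s \<le> t\<close> by simp
        then have "((\<lambda>\<sigma>. \<phi> (S (t - s - \<sigma>) (g (s + \<sigma>)))) has_integral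
            \<phi> (z t - S (t - s) (z s))) {0..t - s}"
          using has_integral_linear[OF _ blinfun.bounded_linear_right[of \<phi>]] by (simp add: o_def)
        moreover have "((\<lambda>\<sigma>. - p x + \<epsilon> + 3 * N * \<epsilon>) has_integral
            (t - s) * (- p x + \<epsilon> + 3 * N * \<epsilon>)) {0..t - s}"
          using has_integral_const_real[of "- p x + \<epsilon> + 3 * N * \<epsilon>" 0 "t - s"] \<open>s \<le> t\<close> by simp
        moreover have "\<phi> (S (t - s - \<sigma>) (g (s + \<sigma>))) \<le> - p x + \<epsilon> + 3 * N * \<epsilon>"
          if \<sigma>: "\<sigma> \<in> {0..t - s}" for \<sigma>
        proof -
          let ?h = "t - s - \<sigma>"
          have h: "0 \<le> ?h" "\<bar>?h\<bar> < d4" using \<sigma> st d by auto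
          have "\<bar>s + \<sigma> - x\<bar> < d2" using \<sigma> st d by auto
          then have "norm (S ?h (g (s + \<sigma>)) - S ?h (g x)) < \<epsilon>"
            using norm_semigroup_diff_le[OF S h(1), of "g (s + \<sigma>)" "g x"] d2(2)[of "s + \<sigma>"] \<sigma> s
            by auto
          moreover have "norm (S ?h (g x) - g x) < \<epsilon>" using d4(2)[OF h(2)] h(1) by simp
          ultimately have "norm (S ?h (g (s + \<sigma>)) - g t) \<le> 3 * \<epsilon>"
            using gt norm_triangle_ineq[of "S ?h (g (s + \<sigma>)) - S ?h (g x)" "S ?h (g x) - g x"]
              norm_triangle_ineq4[of "S ?h (g (s + \<sigma>)) - g x" "g t - g x"] by simp
          then have "\<phi> (S ?h (g (s + \<sigma>)) - g t) \<le> N * (3 * \<epsilon>)"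
            using norm_blinfun[of \<phi> "S ?h (g (s + \<sigma>)) - g t"] zt n\<phi> N
              mult_mono[of "norm \<phi>" N "norm (S ?h (g (s + \<sigma>)) - g t)" "3 * \<epsilon>"] by simp
          then show ?thesis using \<phi>(2) pt by (simp add: blinfun.diff_right)
        qed
        ultimately have "\<phi> (z t - S (t - s) (z s)) \<le> (t - s) * (- p x + \<epsilon> + 3 * N * \<epsilon>)"
          by (rule has_integral_le)
        moreover have "\<phi> (S (t - s) (z s)) \<le> ((norm (z t))\<^sup>2 + (norm (z s))\<^sup>2) / 2"
        proof -
          have "\<phi> (S (t - s) (z s)) \<le> norm (z t) * norm (z s)"
            using norm_blinfun[of \<phi> "S (t - s) (z s)"] norm_semigroup_le[OF S, of "t - s" "z s"] n\<phi> \<open>s \<le> t\<close>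
              mult_left_mono[of "norm (S (t - s) (z s))" "norm (z s)" "norm \<phi>"] by simp
          also have "\<dots> \<le> ((norm (z t))\<^sup>2 + (norm (z s))\<^sup>2) / 2"
            using sum_squares_bound[of "norm (z t)" "norm (z s)"] by simp
          finally show ?thesis .
        qed
        moreover have "integral {s..t} p \<le> (t - s) * (p x + \<epsilon>)"
        proof -
          have "p \<sigma> \<le> p x + \<epsilon>" if \<sigma>: "\<sigma> \<in> {s..t}" for \<sigma>
          proof -
            have "\<bar>\<sigma> - x\<bar> < d3" using \<sigma> st d by auto
            then have "\<bar>p \<sigma> - p x\<bar> < \<epsilon>" using \<sigma> s by (intro d3(2)) auto
            then show ?thesis by simp
          qed
          then have "integral {s..t} p \<le> integral {s..t} (\<lambda>_. p x + \<epsilon>)"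
            by (intro integral_le pint s) auto
          then show ?thesis using \<open>s \<le> t\<close> by simp
        qed
        moreover have "\<eta> * (t - s) = (t - s) * ((6 * N + 4) * \<epsilon>)" by (simp add: eta)
        ultimately show "(norm (z t))\<^sup>2 + 2 * integral {s..t} p \<le> (norm (z s))\<^sup>2 + \<eta> * (t - s)"
          using \<phi>z by (simp add: blinfun.diff_right algebra_simps)
      qed
      then show ?case using d(1) by blast
    qed
    then show ?thesis using ab unfolding P_def by simp
  qed
  show ?thesis
  proof (rule field_le_epsilon)
    fix e :: real assume e: "0 < e"
    have "e / (b - a + 1) * (b - a) \<le> e" using e ab by (simp add: field_simps)
    then show "(norm (z b))\<^sup>2 + 2 * integral {a..b} p \<le> (norm (z a))\<^sup>2 + e"
      using approx[of "e / (b - a + 1)"] e ab by simp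
  qed
qed

end

section \<open>The feedback law\<close>

text \<open>For \<open>\<beta> = BJ B\<close>, the closed-loop forcing is \<open>- r\<close> times the image of this vector under \<open>B\<close>.
  Dividing by zero gives the required value 0 at the origin, so no case distinction appears. The
  energy lost per unit of time is at least \<open>2 * r\<close> times the square of its norm.\<close>

definition rescaled :: "('a::real_normed_vector \<Rightarrow> real) \<Rightarrow> 'a \<Rightarrow> 'a" where
  "rescaled \<beta> y = (\<beta> y / (norm y)\<^sup>2) *\<^sub>R y"

lemma norm_rescaled: "norm (rescaled \<beta> y) = \<bar>\<beta> y\<bar> / norm y"
  by (simp add: rescaled_def power2_eq_square)

text \<open>The quadratic growth of \<open>\<beta>\<close> is cancelled by the denominator, which makes the feedback
  law globally Lipschitz although it is a quotient with a singularity at the origin. The constant is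
  \<open>C\<close> for the change of the vector factor, \<open>C\<close> for the change of \<open>\<beta>\<close> and \<open>2 * C\<close> for that of the
  denominator, if \<open>y\<close> is taken to be the longer of the two vectors.\<close>

lemma rescaled_lipschitz:
  fixes \<beta> :: "'a::real_normed_vector \<Rightarrow> real"
  assumes \<beta>: "\<And>y z. \<bar>\<beta> y - \<beta> z\<bar> \<le> C * max (norm y) (norm z) * norm (y - z)"
    and \<beta>0: "\<beta> 0 = 0"
  shows "norm (rescaled \<beta> y - rescaled \<beta> z) \<le> 4 * C * norm (y - z)"
proof -
  have size: "\<bar>\<beta> x\<bar> \<le> C * (norm x)\<^sup>2" for x
    using \<beta>[of x 0] \<beta>0 by (simp add: power2_eq_square)
  have ordered: "norm (rescaled \<beta> y - rescaled \<beta> z) \<le> 4 * C * norm (y - z)" if yz: "norm z \<le> norm y" for y z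
  proof (cases "z = 0 \<or> y = z")
    case True
    moreover have 1: "norm (rescaled \<beta> y) \<le> C * norm y"
      using size[of y] by (cases "y = 0") (auto simp: norm_rescaled divide_le_eq power2_eq_square)
    moreover have "0 \<le> C * norm y" by (rule order_trans[OF norm_ge_zero 1])
    ultimately show ?thesis by (auto simp: rescaled_def[of \<beta> 0])
  next
    case False
    then have z: "0 < norm z" and y: "0 < norm y" using yz by auto
    then have C: "0 \<le> C" using size[of y] by (smt (verit) mult_neg_pos zero_less_power)
    let ?d = "norm (y - z)"
    have tri: "norm (u + v + w) \<le> norm u + norm v + norm w" for u v w :: 'a
      using norm_triangle_ineq[of "u + v" w] norm_triangle_ineq[of u v] by linarith
    have dn: "norm y - norm z \<le> ?d" by (rule norm_triangle_ineq2)
    have "\<bar>\<beta> y / (norm y)\<^sup>2\<bar> * ?d \<le> C * ?d"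
      using size[of y] y by (intro mult_right_mono) (auto simp: divide_le_eq)
    moreover have "\<bar>(\<beta> y - \<beta> z) / (norm y)\<^sup>2\<bar> * norm z \<le> C * ?d"
    proof -
      have "\<bar>\<beta> y - \<beta> z\<bar> * norm z \<le> (C * norm y * ?d) * norm y"
        using \<beta>[of y z] yz C by (intro mult_mono) (auto simp: max_def split: if_splits)
      then show ?thesis using y by (simp add: divide_le_eq power2_eq_square mult_ac)
    qed
    moreover have "\<bar>\<beta> z * (1 / (norm y)\<^sup>2 - 1 / (norm z)\<^sup>2)\<bar> * norm z \<le> 2 * C * ?d"
    proof -
      have "\<bar>1 / (norm y)\<^sup>2 - 1 / (norm z)\<^sup>2\<bar> = ((norm y)\<^sup>2 - (norm z)\<^sup>2) / ((norm y)\<^sup>2 * (norm z)\<^sup>2)"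
      proof -
        have "1 / (norm y)\<^sup>2 - 1 / (norm z)\<^sup>2 = - (((norm y)\<^sup>2 - (norm z)\<^sup>2) / ((norm y)\<^sup>2 * (norm z)\<^sup>2))"
          using y z by (simp add: diff_frac_eq minus_divide_left)
        then show ?thesis using yz by (simp add: power_mono)
      qed
      then have "\<bar>\<beta> z * (1 / (norm y)\<^sup>2 - 1 / (norm z)\<^sup>2)\<bar> * norm z =
          \<bar>\<beta> z\<bar> * (((norm y)\<^sup>2 - (norm z)\<^sup>2) / ((norm y)\<^sup>2 * (norm z)\<^sup>2) * norm z)"
        by (simp add: abs_mult)
      also have "\<dots> \<le> (C * (norm z)\<^sup>2) * (((norm y)\<^sup>2 - (norm z)\<^sup>2) / ((norm y)\<^sup>2 * (norm z)\<^sup>2) * norm z)"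
        using size[of z] yz by (intro mult_right_mono) (auto simp: power_mono)
      also have "\<dots> = C * (((norm y)\<^sup>2 - (norm z)\<^sup>2) * norm z / (norm y)\<^sup>2)"
        using z by simp
      also have "\<dots> = C * ((norm y - norm z) * ((norm y + norm z) * norm z) / (norm y)\<^sup>2)"
        by (simp only: power2_eq_square square_diff_square_factored mult.assoc mult.left_commute)
      also have "\<dots> \<le> C * (?d * ((norm y + norm y) * norm y) / (norm y)\<^sup>2)"
        using C dn yz by (intro mult_left_mono divide_right_mono mult_mono) auto
      also have "\<dots> = 2 * C * ?d" using y by (simp add: power2_eq_square)
      finally show ?thesis .
    qed
    moreover have split: "rescaled \<beta> y - rescaled \<beta> z = (\<beta> y / (norm y)\<^sup>2) *\<^sub>R (y - z)
        + ((\<beta> y - \<beta> z) / (norm y)\<^sup>2) *\<^sub>R z + (\<beta> z * (1 / (norm y)\<^sup>2 - 1 / (norm z)\<^sup>2)) *\<^sub>R z"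
      by (simp add: rescaled_def algebra_simps diff_divide_distrib)
    have "norm (rescaled \<beta> y - rescaled \<beta> z) \<le> \<bar>\<beta> y / (norm y)\<^sup>2\<bar> * ?d
        + \<bar>(\<beta> y - \<beta> z) / (norm y)\<^sup>2\<bar> * norm z + \<bar>\<beta> z * (1 / (norm y)\<^sup>2 - 1 / (norm z)\<^sup>2)\<bar> * norm z"
      unfolding split by (rule order_trans[OF tri]) (simp only: norm_scaleR order_refl)
    ultimately show ?thesis by linarith
  qed
  show ?thesis
    using ordered[of y z] ordered[of z y] by (cases "norm z \<le> norm y") (auto simp: norm_minus_commute)
qed

lemma BJ_eq:
  assumes "BJ_single_valued B" "\<phi> \<in> duality_map y"
  shows "BJ B y = \<phi> (B y)"
  unfolding BJ_def
proof (rule the_equality)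
  show "\<exists>\<psi>\<in>duality_map y. \<phi> (B y) = \<psi> (B y)" using assms(2) by blast
  show "c = \<phi> (B y)" if "\<exists>\<psi>\<in>duality_map y. c = \<psi> (B y)" for c
    using that assms unfolding BJ_single_valued_def by metis
qed

lemma BJ_zero:
  assumes "BJ_single_valued B" shows "BJ B 0 = 0"
  using BJ_eq[OF assms, of _ 0] duality_map_nonempty[of "0::'a::real_normed_vector"]
  by (metis blinfun.zero_right)

lemma feedback_scaleR:
  "feedback B r y *\<^sub>R B y = B ((- r) *\<^sub>R rescaled (BJ B) y)"
  by (simp add: feedback_def rescaled_def blinfun.scaleR_right blinfun.minus_right blinfun.zero_right)

lemma closed_loop_iff_mild:
  "closed_loop_mild_solution S B (feedback B r) z0 z \<longleftrightarrow>
    forced_mild S (\<lambda>s. B ((- r) *\<^sub>R rescaled (BJ B) (z s))) z0 z"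
proof -
  have "(\<exists>I. (f has_integral I) {0..t} \<and> z t = S t z0 + I) \<longleftrightarrow> (f has_integral z t - S t z0) {0..t}"
    for t f
    by (metis add_diff_cancel_left' add.commute diff_add_cancel)
  then show ?thesis
    unfolding closed_loop_mild_solution_def mild_solution_def forced_mild_def feedback_scaleR by simp
qed

section \<open>Scalar inequalities\<close>

text \<open>Cauchy--Schwarz against the constant 1, obtained by integrating
  \<open>2 * m * f t - m\<^sup>2 \<le> (f t)\<^sup>2\<close> for the mean value \<open>m\<close> of \<open>f\<close>.\<close>

lemma integral_square_le:
  fixes f :: "real \<Rightarrow> real"
  assumes f: "continuous_on {0..T} f" and T: "0 < T"
  shows "(integral {0..T} f)\<^sup>2 \<le> T * integral {0..T} (\<lambda>t. (f t)\<^sup>2)"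
proof -
  define m where "m = integral {0..T} f / T"
  have m: "integral {0..T} f = m * T" using T by (simp add: m_def)
  have "((\<lambda>t. 2 * m * f t - m\<^sup>2) has_integral 2 * m * (m * T) - m\<^sup>2 * T) {0..T}"
    using has_integral_const_real[of "m\<^sup>2" 0 T] T
      integrable_integral[OF integrable_continuous_interval[OF f]] unfolding m
    by (intro has_integral_diff has_integral_mult_right) (auto simp: mult.commute)
  moreover have "((\<lambda>t. (f t)\<^sup>2) has_integral integral {0..T} (\<lambda>t. (f t)\<^sup>2)) {0..T}"
    by (intro integrable_integral integrable_continuous_interval continuous_intros f)
  moreover have "2 * m * f t - m\<^sup>2 \<le> (f t)\<^sup>2" for t
    using zero_le_power2[of "f t - m"] by (simp add: power2_diff algebra_simps)
  ultimately have "2 * m * (m * T) - m\<^sup>2 * T \<le> integral {0..T} (\<lambda>t. (f t)\<^sup>2)"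
    using has_integral_le by blast
  then have "m\<^sup>2 * T \<le> integral {0..T} (\<lambda>t. (f t)\<^sup>2)"
    by (simp add: power2_eq_square algebra_simps)
  then have "T * (m\<^sup>2 * T) \<le> T * integral {0..T} (\<lambda>t. (f t)\<^sup>2)"
    using T by (intro mult_left_mono) auto
  then show ?thesis by (simp add: m power2_eq_square algebra_simps)
qed

text \<open>If \<open>X\<close> exceeds \<open>Y / 2\<close>, then the left-hand side of the last hypothesis is at least \<open>Y\<^sup>2 / 4\<close>,
  which keeps \<open>X\<close> away from \<open>Y\<close> by a fixed proportion of \<open>Y\<close>.\<close>

lemma quadratic_gap:
  fixes X Y c :: real
  assumes "0 \<le> X" "X \<le> Y" "0 < c" and gap: "X\<^sup>2 \<le> c * Y * (Y - X)"
  shows "X \<le> max (1/2) (1 - 1 / (4 * c)) * Y"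
proof (cases "X \<le> Y / 2")
  case True
  then have "X \<le> 1/2 * Y" by simp
  also have "\<dots> \<le> max (1/2) (1 - 1 / (4 * c)) * Y" using assms by (intro mult_right_mono) auto
  finally show ?thesis .
next
  case False
  then have Y: "0 < Y" using assms by simp
  have "(Y / 2)\<^sup>2 \<le> X\<^sup>2" using False Y by (intro power_mono) auto
  then have "Y * (Y / 4) \<le> Y * (c * (Y - X))" using gap by (simp add: power2_eq_square algebra_simps)
  then have "Y / 4 \<le> c * (Y - X)" by (simp only: mult_le_cancel_left_pos[OF Y])
  then have "(Y / 4) / c \<le> Y - X" using pos_divide_le_eq[OF assms(3)] by (metis mult.commute)
  then have "X \<le> (1 - 1 / (4 * c)) * Y" by (simp add: algebra_simps)
  also have "\<dots> \<le> max (1/2) (1 - 1 / (4 * c)) * Y" using Y by (intro mult_right_mono) auto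
  finally show ?thesis .
qed

text \<open>The factor \<open>1 / \<gamma>\<close> pays for the incomplete last period.\<close>

lemma exponential_decay:
  fixes f :: "real \<Rightarrow> real"
  assumes mono: "\<And>s t. 0 \<le> s \<Longrightarrow> s \<le> t \<Longrightarrow> f t \<le> f s" and f0: "0 \<le> f 0"
    and step: "\<And>t. 0 \<le> t \<Longrightarrow> f (t + T) \<le> \<gamma> * f t"
    and T: "0 < T" and \<gamma>: "0 < \<gamma>" "\<gamma> < 1" and t: "0 \<le> t"
  shows "f t \<le> 1 / \<gamma> * exp (- (- ln \<gamma> / T) * t) * f 0"
proof -
  define n where "n = nat \<lfloor>t / T\<rfloor>"
  have n: "real n \<le> t / T" "t / T - 1 \<le> real n"
    using T t by (auto simp: n_def)
  have pow: "f (real k * T) \<le> \<gamma> ^ k * f 0" for k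
  proof (induction k)
    case (Suc k)
    have "f (real k * T + T) \<le> \<gamma> * f (real k * T)" using T by (intro step) simp
    also have "\<dots> \<le> \<gamma> * (\<gamma> ^ k * f 0)" using \<gamma> Suc.IH by (intro mult_left_mono) auto
    finally show ?case by (simp add: algebra_simps)
  qed simp
  have "f t \<le> f (real n * T)" using n(1) T by (intro mono) (auto simp: field_simps)
  also have "\<dots> \<le> \<gamma> ^ n * f 0" by (rule pow)
  also have "\<gamma> ^ n = exp (real n * ln \<gamma>)" using \<gamma> by (simp add: exp_of_nat_mult)
  also have "exp (real n * ln \<gamma>) * f 0 \<le> exp ((t / T - 1) * ln \<gamma>) * f 0"
    using n(2) \<gamma> f0 by (intro mult_right_mono) (auto intro: mult_right_mono_neg)
  also have "exp ((t / T - 1) * ln \<gamma>) = 1 / \<gamma> * exp (- (- ln \<gamma> / T) * t)"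
  proof -
    have "(t / T - 1) * ln \<gamma> = - (- ln \<gamma> / T) * t - ln \<gamma>" by (simp add: algebra_simps)
    then show ?thesis using \<gamma>(1) by (simp only: exp_diff exp_ln) simp
  qed
  finally show ?thesis .
qed

section \<open>Decay over one period and stabilization\<close>

text \<open>Everything is measured by the integral \<open>P\<close> of \<open>norm (rescaled \<beta> (z t))\<close> over one period.
  The controlled and the free trajectory differ by at most \<open>r * norm B * P\<close>, so the observability
  inequality for the free one bounds the final energy \<open>(norm (z T))\<^sup>2\<close> by \<open>norm x * P * M\<close>. The
  energy that is lost bounds \<open>P\<^sup>2\<close>. Together these make the final energy at most a fixed fraction
  of the initial one.\<close>

lemma mild_period_contraction:
  fixes S :: "real \<Rightarrow> ('a::banach \<Rightarrow>\<^sub>L 'a)" and B :: "'a \<Rightarrow>\<^sub>L 'a" and \<beta> :: "'a \<Rightarrow> real"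
  assumes S: "contraction_semigroup S"
    and \<beta>: "\<And>y z. \<bar>\<beta> y - \<beta> z\<bar> \<le> C * max (norm y) (norm z) * norm (y - z)"
    and \<beta>0: "\<beta> 0 = 0"
    and pos: "0 < C" "0 < r" "0 < T" "0 < \<delta>"
    and z: "forced_mild S (\<lambda>s. B ((- r) *\<^sub>R rescaled \<beta> (z s))) x z"
    and bound: "\<And>t. 0 \<le> t \<Longrightarrow> norm (z t) \<le> norm x"
    and energy: "(norm (z T))\<^sup>2 + 2 * r * integral {0..T} (\<lambda>t. (norm (rescaled \<beta> (z t)))\<^sup>2) \<le> (norm x)\<^sup>2"
    and obs: "\<delta> * (norm (S T x))\<^sup>2 \<le> integral {0..T} (\<lambda>t. \<bar>\<beta> (S t x)\<bar>)"
    and M: "M = 2 * (1 + C * r * norm B * T) / \<delta> + 2 * (r * norm B)\<^sup>2 * T * C" and M0: "0 < M"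
  shows "(norm (z T))\<^sup>2 \<le> max (1/2) (1 - 1 / (4 * (T * M\<^sup>2 / (2 * r)))) * (norm x)\<^sup>2"
proof -
  let ?b = "norm B" and ?N = "norm x" and ?G = "\<lambda>t. norm (rescaled \<beta> (z t))"
  define P where "P = integral {0..T} ?G"
  have lip: "norm (rescaled \<beta> y - rescaled \<beta> w) \<le> 4 * C * norm (y - w)" for y w
    by (rule rescaled_lipschitz[OF \<beta> \<beta>0])
  have size: "\<bar>\<beta> y\<bar> \<le> C * norm y * norm y" for y using \<beta>[of y 0] \<beta>0 by simp
  have G: "continuous_on A ?G" if "A \<subseteq> {0..}" for A
    by (intro continuous_on_norm continuous_on_lipschitz[OF lip]
        continuous_on_subset[OF forced_mild_continuous[OF z] that])
  have Gint: "?G integrable_on {0..t}" for t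
    by (intro integrable_continuous_interval G) auto
  have P0: "0 \<le> P" unfolding P_def by (rule integral_nonneg[OF Gint]) simp
  have deviation: "norm (z t - S t x) \<le> r * ?b * P" if t: "t \<in> {0..T}" for t
  proof -
    have "((\<lambda>s. S (t - s) (B ((- r) *\<^sub>R rescaled \<beta> (z s)))) has_integral z t - S t x) {0..t}"
      using forced_mild_has_integral[OF z] t by simp
    moreover have "((\<lambda>s. r * ?b * ?G s) has_integral r * ?b * integral {0..t} ?G) {0..t}"
      by (intro has_integral_mult_right integrable_integral Gint)
    moreover have "norm (S (t - s) (B ((- r) *\<^sub>R rescaled \<beta> (z s)))) \<le> (r * ?b * ?G s) \<bullet> 1"
      if "s \<in> {0..t}" for s
    proof -
      have "norm (S (t - s) (B ((- r) *\<^sub>R rescaled \<beta> (z s)))) \<le> norm (B ((- r) *\<^sub>R rescaled \<beta> (z s)))"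
        using that by (intro norm_semigroup_le[OF S]) simp
      also have "\<dots> \<le> ?b * norm ((- r) *\<^sub>R rescaled \<beta> (z s))" by (rule norm_blinfun)
      finally show ?thesis using pos by (simp add: mult_ac)
    qed
    ultimately have "norm (z t - S t x) \<le> (r * ?b * integral {0..t} ?G) \<bullet> 1"
      by (rule has_integral_norm_bound_integral_component)
    moreover have "integral {0..t} ?G \<le> P"
      unfolding P_def by (rule integral_subset_le) (use t Gint in auto)
    then have "r * ?b * integral {0..t} ?G \<le> r * ?b * P"
      using pos by (intro mult_left_mono) auto
    ultimately show ?thesis by simp
  qed
  have "\<bar>\<beta> (S t x)\<bar> \<le> ?N * ?G t + C * ?N * (r * ?b * P)" if t: "t \<in> {0..T}" for t
  proof -
    have zt: "norm (z t) \<le> ?N" and St: "norm (S t x) \<le> ?N"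
      using t bound norm_semigroup_le[OF S] by auto
    have "\<bar>\<beta> (S t x) - \<beta> (z t)\<bar> \<le> C * max (norm (S t x)) (norm (z t)) * norm (S t x - z t)"
      by (rule \<beta>)
    also have "\<dots> \<le> C * ?N * (r * ?b * P)"
      using zt St pos deviation[OF t] by (intro mult_mono) (auto simp: norm_minus_commute le_max_iff_disj)
    finally have "\<bar>\<beta> (S t x)\<bar> \<le> \<bar>\<beta> (z t)\<bar> + C * ?N * (r * ?b * P)" by linarith
    moreover have "\<bar>\<beta> (z t)\<bar> = norm (z t) * ?G t"
      using \<beta>0 by (cases "z t = 0") (auto simp: norm_rescaled)
    moreover have "norm (z t) * ?G t \<le> ?N * ?G t" using zt by (intro mult_right_mono) auto
    ultimately show ?thesis by simp
  qed
  moreover have "((\<lambda>t. ?N * ?G t + C * ?N * (r * ?b * P)) has_integral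
      ?N * P + T * (C * ?N * (r * ?b * P))) {0..T}"
    unfolding P_def using has_integral_const_real[of "C * ?N * (r * ?b * integral {0..T} ?G)" 0 T] pos
    by (intro has_integral_add has_integral_mult_right integrable_integral Gint) simp
  moreover have "(\<lambda>t. \<bar>\<beta> (S t x)\<bar>) integrable_on {0..T}"
  proof -
    have "continuous_on {0..T} (\<lambda>t. S t x)"
      by (intro continuous_on_semigroup[OF S] continuous_intros) auto
    then have "continuous_on {0..T} (\<lambda>t. norm (rescaled \<beta> (S t x)) * norm (S t x))"
      by (intro continuous_on_mult continuous_on_norm continuous_on_lipschitz[OF lip])
    moreover have "norm (rescaled \<beta> y) * norm y = \<bar>\<beta> y\<bar>" for y
      using \<beta>0 by (cases "y = 0") (auto simp: norm_rescaled)
    ultimately show ?thesis by (intro integrable_continuous_interval) simp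
  qed
  ultimately have "integral {0..T} (\<lambda>t. \<bar>\<beta> (S t x)\<bar>) \<le> ?N * P + T * (C * ?N * (r * ?b * P))"
    using has_integral_le integrable_integral by (metis (no_types, lifting))
  then have "\<delta> * (norm (S T x))\<^sup>2 \<le> ?N * P * (1 + C * r * ?b * T)"
    using obs by (simp add: algebra_simps)
  then have free: "2 * (norm (S T x))\<^sup>2 \<le> ?N * P * (2 * (1 + C * r * ?b * T) / \<delta>)"
    using pos by (simp add: field_simps)
  have "P \<le> T * (C * ?N)"
  proof -
    have "?G t \<le> C * ?N" if t: "t \<in> {0..T}" for t
    proof -
      have "?G t \<le> C * norm (z t)"
        using size[of "z t"] by (cases "z t = 0") (auto simp: norm_rescaled divide_le_eq)
      also have "\<dots> \<le> C * ?N" using bound[of t] t pos by simp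
      finally show ?thesis .
    qed
    then have "P \<le> integral {0..T} (\<lambda>_. C * ?N)"
      unfolding P_def by (intro integral_le Gint) auto
    then show ?thesis using pos by (simp add: mult_ac)
  qed
  then have "P * P \<le> P * (T * (C * ?N))" using P0 by (rule mult_left_mono)
  then have "2 * (r * ?b)\<^sup>2 * (P * P) \<le> 2 * (r * ?b)\<^sup>2 * (P * (T * (C * ?N)))"
    by (rule mult_left_mono) simp
  then have dev: "2 * (r * ?b * P)\<^sup>2 \<le> ?N * P * (2 * (r * ?b)\<^sup>2 * T * C)"
    by (simp add: power2_eq_square algebra_simps)
  have "norm (z T) \<le> norm (S T x) + r * ?b * P"
    using norm_triangle_ineq[of "S T x" "z T - S T x"] deviation[of T] pos by simp
  then have "(norm (z T))\<^sup>2 \<le> (norm (S T x) + r * ?b * P)\<^sup>2" by (rule power_mono) simp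
  also have "\<dots> \<le> 2 * (norm (S T x))\<^sup>2 + 2 * (r * ?b * P)\<^sup>2"
    using sum_squares_bound[of "norm (S T x)" "r * ?b * P"] by (simp add: power2_sum)
  also have "\<dots> \<le> ?N * P * M" using free dev unfolding M distrib_left by linarith
  finally have end_bound: "(norm (z T))\<^sup>2 \<le> ?N * P * M" .
  \<comment> \<open>Squaring brings in \<open>P\<^sup>2\<close>, which the energy lost over the period controls.\<close>
  have "((norm (z T))\<^sup>2)\<^sup>2 \<le> (?N * P * M)\<^sup>2" by (rule power_mono[OF end_bound]) simp
  also have "\<dots> = ?N\<^sup>2 * M\<^sup>2 * P\<^sup>2" by (simp add: power_mult_distrib mult_ac)
  also have "\<dots> \<le> ?N\<^sup>2 * M\<^sup>2 * (T * ((?N\<^sup>2 - (norm (z T))\<^sup>2) / (2 * r)))"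
  proof (rule mult_left_mono)
    have "P\<^sup>2 \<le> T * integral {0..T} (\<lambda>t. (?G t)\<^sup>2)"
      unfolding P_def using G pos by (intro integral_square_le) auto
    also have "\<dots> \<le> T * ((?N\<^sup>2 - (norm (z T))\<^sup>2) / (2 * r))"
      using energy pos by (intro mult_left_mono) (auto simp: field_simps)
    finally show "P\<^sup>2 \<le> T * ((?N\<^sup>2 - (norm (z T))\<^sup>2) / (2 * r))" .
  qed simp
  also have "\<dots> = T * M\<^sup>2 / (2 * r) * ?N\<^sup>2 * (?N\<^sup>2 - (norm (z T))\<^sup>2)" by (simp add: mult_ac)
  finally have "((norm (z T))\<^sup>2)\<^sup>2 \<le> T * M\<^sup>2 / (2 * r) * ?N\<^sup>2 * (?N\<^sup>2 - (norm (z T))\<^sup>2)" .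
  moreover have "(norm (z T))\<^sup>2 \<le> ?N\<^sup>2" using bound[of T] pos by (intro power_mono) auto
  moreover have "0 < T * M\<^sup>2 / (2 * r)" using M0 pos by simp
  ultimately show ?thesis by (intro quadratic_gap) auto
qed

theorem theorem7p3:
  fixes A :: "'a::banach \<Rightarrow> 'a" and D :: "'a set"
    and S :: "real \<Rightarrow> ('a \<Rightarrow>\<^sub>L 'a)"
    and B :: "'a \<Rightarrow>\<^sub>L 'a"
    and K :: "real \<Rightarrow> real \<Rightarrow> real"
    and C T \<delta> :: real
  assumes "generates D A S"
    and "contraction_semigroup S"
    and "BJ_single_valued B"
    and "\<And>y z. \<bar>BJ B y - BJ B z\<bar> \<le> K (norm y) (norm z) * norm (y - z)"
    and "\<And>s1 s2. 0 \<le> s1 \<Longrightarrow> 0 \<le> s2 \<Longrightarrow> 0 \<le> K s1 s2"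
    and "\<And>s1 s2 r1 r2. 0 \<le> s1 \<Longrightarrow> s1 \<le> r1 \<Longrightarrow> 0 \<le> s2 \<Longrightarrow> s2 \<le> r2 \<Longrightarrow> K s1 s2 \<le> K r1 r2"
    and "continuous_on {0..} (\<lambda>s. K s s)"
    and "C > 0"
    and "\<And>s. 0 \<le> s \<Longrightarrow> K s s \<le> C * s"
    and "T > 0" and "\<delta> > 0"
    and "\<And>y. integral {0..T} (\<lambda>t. \<bar>BJ B (blinfun_apply (S t) y)\<bar>)
              \<ge> \<delta> * (norm (blinfun_apply (S T) y))\<^sup>2"
  shows "\<exists>r0>0. \<forall>r. 0 < r \<and> r < r0 \<longrightarrow>
           uniformly_exponentially_stabilizes S B (feedback B r)"
proof -
  note S = assms(2) and single = assms(3) and pos = assms(8,10,11)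
  let ?G = "rescaled (BJ B)"
  have \<beta>: "\<bar>BJ B y - BJ B z\<bar> \<le> C * max (norm y) (norm z) * norm (y - z)" for y z
  proof -
    have "K (norm y) (norm z) \<le> K (max (norm y) (norm z)) (max (norm y) (norm z))"
      by (intro assms(6)) auto
    also have "\<dots> \<le> C * max (norm y) (norm z)" by (intro assms(9)) (simp add: le_max_iff_disj)
    finally have "K (norm y) (norm z) * norm (y - z) \<le> C * max (norm y) (norm z) * norm (y - z)"
      by (rule mult_right_mono) simp
    then show ?thesis using assms(4)[of y z] by linarith
  qed
  have lip: "norm (?G y - ?G w) \<le> 4 * C * norm (y - w)" for y w
    by (rule rescaled_lipschitz[OF \<beta> BJ_zero[OF single]])
  have "uniformly_exponentially_stabilizes S B (feedback B r)" if r: "0 < r" for r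
  proof -
    define F where "F y = B ((- r) *\<^sub>R ?G y)" for y
    define L where "L = norm B * (r * (4 * C))"
    have L: "0 \<le> L" using pos r by (simp add: L_def)
    have F: "norm (F y - F w) \<le> L * norm (y - w)" for y w
    proof -
      have G: "norm (?G y - ?G w) \<le> 4 * C * norm (y - w)" by (rule lip)
      have "norm (F y - F w) \<le> norm B * norm ((- r) *\<^sub>R (?G y - ?G w))"
        unfolding F_def blinfun.diff_right[symmetric] scaleR_diff_right[symmetric] by (rule norm_blinfun)
      also have "\<dots> \<le> norm B * (r * (4 * C * norm (y - w)))"
        using mult_left_mono[OF G, of r] r by (intro mult_left_mono) auto
      finally show ?thesis by (simp add: L_def mult_ac)
    qed
    have cont: "continuous_on {0..} (\<lambda>s. F (z s))" "continuous_on {0..} (\<lambda>s. (norm (?G (z s)))\<^sup>2)"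
      if "forced_mild S (\<lambda>s. F (z s)) x z" for x z
      using forced_mild_continuous[OF that]
      by (auto intro!: continuous_intros continuous_on_lipschitz[OF F] continuous_on_lipschitz[OF lip])
    have energy: "(norm (z b))\<^sup>2 + 2 * r * integral {a..b} (\<lambda>t. (norm (?G (z t)))\<^sup>2) \<le> (norm (z a))\<^sup>2"
      if z: "forced_mild S (\<lambda>s. F (z s)) x z" and ab: "0 \<le> a" "a \<le> b" for x z a b
    proof -
      have "\<exists>\<phi>\<in>duality_map (z t). \<phi> (F (z t)) \<le> - (r * (norm (?G (z t)))\<^sup>2)" for t
      proof -
        \<comment> \<open>Paired with \<open>\<phi>\<close>, the forcing reproduces the value \<open>BJ B (z t)\<close> that
          occurs in the feedback, so the sign of the product is known.\<close>
        obtain \<phi> where \<phi>: "\<phi> \<in> duality_map (z t)" using duality_map_nonempty by blast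
        have "\<phi> (F (z t)) = - r * (BJ B (z t) / (norm (z t))\<^sup>2) * \<phi> (B (z t))"
          by (simp add: F_def rescaled_def blinfun.scaleR_right blinfun.minus_right)
        also have "\<dots> = - (r * (norm (?G (z t)))\<^sup>2)"
          unfolding BJ_eq[OF single \<phi>, symmetric] norm_rescaled
          by (simp add: power2_eq_square)
        finally show ?thesis by (intro bexI[OF _ \<phi>]) simp
      qed
      then have "(norm (z b))\<^sup>2 + 2 * integral {a..b} (\<lambda>t. r * (norm (?G (z t)))\<^sup>2) \<le> (norm (z a))\<^sup>2"
        using cont[OF z] by (intro forced_mild_dissipation[OF S z _ _ _ ab] continuous_on_mult continuous_on_const) auto
      then show ?thesis by simp
    qed
    have mono: "norm (z b) \<le> norm (z a)" if z: "forced_mild S (\<lambda>s. F (z s)) x z" and ab: "0 \<le> a" "a \<le> b" for x z a b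
    proof -
      have "0 \<le> integral {a..b} (\<lambda>t. (norm (?G (z t)))\<^sup>2)"
        by (intro integral_nonneg integrable_continuous_interval continuous_on_subset[OF cont(2)[OF z]])
          (use ab in auto)
      then have "0 \<le> 2 * r * integral {a..b} (\<lambda>t. (norm (?G (z t)))\<^sup>2)" using r by simp
      then have "(norm (z b))\<^sup>2 \<le> (norm (z a))\<^sup>2" using energy[OF z ab] by linarith
      then show ?thesis by (simp add: power2_le_iff_abs_le)
    qed
    \<comment> \<open>The constants of the one-period estimate do not depend on the solution, so the decay
      rate is uniform in the initial value.\<close>
    define M where "M = 2 * (1 + C * r * norm B * T) / \<delta> + 2 * (r * norm B)\<^sup>2 * T * C"
    define \<rho> where "\<rho> = max (1/2) (1 - 1 / (4 * (T * M\<^sup>2 / (2 * r))))"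
    have M: "0 < M"
    proof -
      have "0 < 1 + C * r * norm B * T" using pos r by (intro add_pos_nonneg) auto
      moreover have "0 \<le> 2 * (r * norm B)\<^sup>2 * T * C" using pos by simp
      ultimately show ?thesis unfolding M_def using pos by (intro add_pos_nonneg) auto
    qed
    have \<rho>: "0 < \<rho>" "\<rho> < 1" unfolding \<rho>_def using M pos r by auto
    have step: "norm (z (t + T)) \<le> sqrt \<rho> * norm (z t)"
      if z: "forced_mild S (\<lambda>s. F (z s)) x z" and t: "0 \<le> t" for x z t
    proof -
      have zt: "forced_mild S (\<lambda>s. F (z (t + s))) (z t) (\<lambda>s. z (t + s))"
        by (rule forced_mild_restart[OF S z cont(1)[OF z] t])
      have "(norm (z (t + T)))\<^sup>2 \<le> \<rho> * (norm (z t))\<^sup>2"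
        unfolding \<rho>_def
      proof (rule mild_period_contraction[OF S \<beta> BJ_zero[OF single] pos(1) r pos(2,3) _ _ _ assms(12) M_def M])
        show "forced_mild S (\<lambda>s. B ((- r) *\<^sub>R ?G (z (t + s)))) (z t) (\<lambda>s. z (t + s))"
          using zt unfolding F_def .
        show "norm (z (t + s)) \<le> norm (z t)" if "0 \<le> s" for s
          using mono[OF z t, of "t + s"] that by simp
        show "(norm (z (t + T)))\<^sup>2 + 2 * r * integral {0..T} (\<lambda>s. (norm (?G (z (t + s))))\<^sup>2) \<le> (norm (z t))\<^sup>2"
          using energy[OF zt, of 0 T] pos by simp
      qed
      then show ?thesis using real_sqrt_le_mono by (fastforce simp: real_sqrt_mult)
    qed
    have decay: "\<exists>z. forced_mild S (\<lambda>s. F (z s)) z0 z \<and>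
        (\<forall>w. forced_mild S (\<lambda>s. F (w s)) z0 w \<longrightarrow> (\<forall>t\<ge>0. w t = z t)) \<and>
        (\<forall>t\<ge>0. norm (z t) \<le> 1 / sqrt \<rho> * exp (- (- ln (sqrt \<rho>) / T) * t) * norm z0)" for z0
    proof -
      obtain z where z: "forced_mild S (\<lambda>s. F (z s)) z0 z" using semilinear_mild_exists[OF S L F] by blast
      have "norm (z t) \<le> 1 / sqrt \<rho> * exp (- (- ln (sqrt \<rho>) / T) * t) * norm z0" if "0 \<le> t" for t
        using exponential_decay[of "\<lambda>t. norm (z t)" T "sqrt \<rho>" t] mono[OF z] step[OF z] pos \<rho> that
        by (simp add: forced_mild_zero[OF S z])
      then show ?thesis using z semilinear_mild_unique[OF S L F z] by blast
    qed
    have "0 < 1 / sqrt \<rho>" using \<rho> by simp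
    moreover have "0 < - ln (sqrt \<rho>) / T" using \<rho> pos by (intro divide_pos_pos) auto
    ultimately show ?thesis
      unfolding uniformly_exponentially_stabilizes_def closed_loop_iff_mild F_def[symmetric]
      using decay by blast
  qed
  \<comment> \<open>The estimates hold for every gain \<open>r > 0\<close>, so any positive threshold can be used.\<close>
  then show ?thesis by (intro exI[of _ 1]) simp
qed

end
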